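(* Let $t\ge 2$ and $d\ge 1$. A set $S\subseteq V_d$ is $t$-Ramsey if and only if it is $t$-layer-Ramsey.
   Context: For $d\ge1$, $[d]=\{1,\dots,d\}$ and $V_d=2^{[d]}$ (the set of all subsets of $[d]$) is the vertex set of the $d$-dimensional hypercube $Q_d$; two sets are adjacent iff their symmetric difference has exactly one element. For $1\le d\le n$, an embedding of $Q_d$ into $Q_n$ is an injective map $\psi:V_d\to V_n$ sending adjacent pairs to adjacent pairs. For $F\subseteq V_d$ and $T\subseteq V_n$, $T$ contains a copy of $F$ if some embedding $\psi:V_d\to V_n$ satisfies $\psi(F)\subseteq T$. A $t$-coloring of $Q_n$ is a map $c:V_n\to[t]$; it contains a monochromatic copy of $F$ if some color class $c^{-1}(i)$ contains a copy of $F$. A set $F\subseteq V_d$ is $t$-Ramsey if there is $n_0$ such that for all $n\ge n_0$ every $t$-coloring of $Q_n$ contains a monochromatic copy of $F$. The $i$th layer of $Q_n$ is $L_i=\{A\subseteq[n]:|A|=i\}$. A $t$-coloring of $Q_n$ is layered if it is constant on each layer. A set $F\subseteq V_d$ is $t$-layer-Ramsey if there is $n_L$ such that for all $n\ge n_L$ every layered $t$-coloring of $Q_n$ contains a monochromatic copy of $F$. *)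

theory Defs
  imports Main "HOL-Library.FuncSet"
begin

definition hypercube_verts :: "nat \<Rightarrow> nat set set" where
  "hypercube_verts d = Pow {1..d}"

definition cube_adj :: "nat set \<Rightarrow> nat set \<Rightarrow> bool" where
  "cube_adj A B \<longleftrightarrow> card (sym_diff A B) = 1"

text \<open>The dimensional constraint \<open>d \<le> n\<close> is not listed: it is forced by injectivity.\<close>

definition cube_embedding :: "nat \<Rightarrow> nat \<Rightarrow> (nat set \<Rightarrow> nat set) \<Rightarrow> bool" where
  "cube_embedding d n \<psi> \<longleftrightarrow>
     \<psi> \<in> hypercube_verts d \<rightarrow> hypercube_verts n \<and>
     inj_on \<psi> (hypercube_verts d) \<and>
     (\<forall>A\<in>hypercube_verts d. \<forall>B\<in>hypercube_verts d. cube_adj A B \<longrightarrow> cube_adj (\<psi> A) (\<psi> B))"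

definition contains_copy :: "nat \<Rightarrow> nat \<Rightarrow> nat set set \<Rightarrow> nat set set \<Rightarrow> bool" where
  "contains_copy d n T F \<longleftrightarrow> (\<exists>\<psi>. cube_embedding d n \<psi> \<and> \<psi> ` F \<subseteq> T)"

text \<open>Only the values of a coloring on the vertices of the cube are constrained.\<close>

definition cube_coloring :: "nat \<Rightarrow> nat \<Rightarrow> (nat set \<Rightarrow> nat) \<Rightarrow> bool" where
  "cube_coloring t n c \<longleftrightarrow> c \<in> hypercube_verts n \<rightarrow> {1..t}"

definition color_class :: "nat \<Rightarrow> (nat set \<Rightarrow> nat) \<Rightarrow> nat \<Rightarrow> nat set set" where
  "color_class n c i = {A \<in> hypercube_verts n. c A = i}"

definition has_mono_copy :: "nat \<Rightarrow> nat \<Rightarrow> nat \<Rightarrow> (nat set \<Rightarrow> nat) \<Rightarrow> nat set set \<Rightarrow> bool" where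
  "has_mono_copy t d n c F \<longleftrightarrow> (\<exists>i\<in>{1..t}. contains_copy d n (color_class n c i) F)"

definition cube_layer :: "nat \<Rightarrow> nat \<Rightarrow> nat set set" where
  "cube_layer n i = {A \<in> hypercube_verts n. card A = i}"

definition layered :: "nat \<Rightarrow> (nat set \<Rightarrow> nat) \<Rightarrow> bool" where
  "layered n c \<longleftrightarrow> (\<forall>i. \<forall>A\<in>cube_layer n i. \<forall>B\<in>cube_layer n i. c A = c B)"

definition ramsey_set :: "nat \<Rightarrow> nat \<Rightarrow> nat set set \<Rightarrow> bool" where
  "ramsey_set t d F \<longleftrightarrow>
     (\<exists>n0. \<forall>n\<ge>n0. \<forall>c. cube_coloring t n c \<longrightarrow> has_mono_copy t d n c F)"

definition layer_ramsey_set :: "nat \<Rightarrow> nat \<Rightarrow> nat set set \<Rightarrow> bool" where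
  "layer_ramsey_set t d F \<longleftrightarrow>
     (\<exists>nL. \<forall>n\<ge>nL. \<forall>c. cube_coloring t n c \<and> layered n c \<longrightarrow> has_mono_copy t d n c F)"

end

(* By Ramsey's theorem for uniform hypergraphs, applied successively to the subsets of each size
   at most m, every t-coloring of a sufficiently large cube becomes layered on the subcube spanned
   by the subsets of some m-element set M. That subcube is a copy of Q_m, so a monochromatic copy
   of S forced in layered colorings of Q_m is found in every coloring of the large cube. *)

theory Submission
  imports Defs "HOL-Library.Ramsey"
begin

text \<open>\<open>ramsey_full\<close> speaks of the ground set \<open>{..<N}\<close> and of colors
  counted from 0; an enumeration of \<open>X\<close> and a shift of the colors by one carry it over
  to \<open>X\<close>. The bound \<open>N\<close> is fixed before \<open>X\<close> and
  \<open>f\<close>, so that these bounds can be nested in an induction.\<close>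

lemma ramsey_uniform:
  "\<exists>N. \<forall>(X::'a set) (f::'a set \<Rightarrow> nat). finite X \<longrightarrow> N \<le> card X \<longrightarrow> f \<in> nsets X r \<rightarrow> {1..t} \<longrightarrow>
     (\<exists>M\<in>nsets X m. \<exists>k. \<forall>A\<in>nsets M r. f A = k)"
proof -
  \<comment> \<open>All \<open>t\<close> entries of the list are \<open>m\<close>, so the
    homogeneous set has size \<open>m\<close> whichever color it gets.\<close>
  obtain N :: nat where N: "partn_lst {..<N} (replicate t m) r"
    using ramsey_full by blast
  show ?thesis
  proof (intro exI allI impI)
    fix X :: "'a set" and f :: "'a set \<Rightarrow> nat"
    assume X: "finite X" "N \<le> card X" and f: "f \<in> nsets X r \<rightarrow> {1..t}"
    obtain h where h: "bij_betw h {..<card X} X"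
      using ex_bij_betw_nat_finite[OF X(1)] by (auto simp: atLeast0LessThan)
    have hN: "h ` {..<N} \<subseteq> X" and inj: "inj_on h {..<N}"
      using h X(2) by (auto simp: bij_betw_def intro: inj_on_subset)
    have hA: "h ` A \<in> nsets X j" if "A \<in> nsets {..<N} j" for A j
      using that hN inj_on_subset[OF inj, of A] by (auto simp: nsets_def card_image)
    have "(\<lambda>A. f (h ` A) - 1) \<in> nsets {..<N} r \<rightarrow> {..<t}"
    proof
      fix A assume "A \<in> nsets {..<N} r"
      then have "f (h ` A) \<in> {1..t}" using f hA by blast
      then show "f (h ` A) - 1 \<in> {..<t}" by auto
    qed
    from N this length_replicate obtain i H where "i < length (replicate t m)"
        "H \<in> nsets {..<N} (replicate t m ! i)" and mono: "(\<lambda>A. f (h ` A) - 1) ` nsets H r \<subseteq> {i}"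
      by (rule partn_lstE)
    then have H: "H \<in> nsets {..<N} m" by simp
    have "f B = Suc i" if "B \<in> nsets (h ` H) r" for B
    proof -
      have "inj_on h H"
        using H inj by (auto simp: nsets_def intro: inj_on_subset)
      with that obtain A where A: "A \<in> nsets H r" "B = h ` A"
        by (rule nset_image_obtains)
      have "A \<in> nsets {..<N} r"
        using A H by (auto simp: nsets_def)
      \<comment> \<open>This excludes \<open>f B = 0\<close>, which truncated subtraction would not
        tell apart from \<open>f B = 1\<close>.\<close>
      then have "f B \<in> {1..t}" using f hA A by blast
      moreover have "f B - 1 = i" using mono A by auto
      ultimately show ?thesis by auto
    qed
    then show "\<exists>M\<in>nsets X m. \<exists>k. \<forall>A\<in>nsets M r. f A = k"
      using hA[OF H] by blast
  qed
qed

text \<open>Induction on the number \<open>r\<close> of sizes already treated. Homogeneity passes to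
  subsets, so shrinking the set to handle one more size keeps what was achieved for the smaller
  ones.\<close>

lemma ramsey_layers:
  "\<exists>N. \<forall>(X::'a set) (f::'a set \<Rightarrow> nat). finite X \<longrightarrow> N \<le> card X \<longrightarrow> f \<in> Pow X \<rightarrow> {1..t} \<longrightarrow>
     (\<exists>M\<in>nsets X m. \<forall>i<r. \<exists>k. \<forall>A\<in>nsets M i. f A = k)"
proof (induction r arbitrary: m)
  case 0
  have "\<exists>M. M \<in> nsets X m" if "finite X" "m \<le> card X" for X :: "'a set"
    using that obtain_subset_with_card_n by (metis (mono_tags) nsets_def mem_Collect_eq)
  then show ?case by auto
next
  case (Suc r)
  \<comment> \<open>The sizes are fixed backwards: \<open>p\<close> is large enough to treat size
    \<open>r\<close> last, and the induction hypothesis is then asked for a set of \<open>p\<close>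
    elements instead of \<open>m\<close>; hence \<open>m\<close> is arbitrary in the
    induction.\<close>
  obtain p where p: "\<forall>(X::'a set) (f::'a set \<Rightarrow> nat). finite X \<longrightarrow> p \<le> card X \<longrightarrow>
      f \<in> nsets X r \<rightarrow> {1..t} \<longrightarrow> (\<exists>M\<in>nsets X m. \<exists>k. \<forall>A\<in>nsets M r. f A = k)"
    using ramsey_uniform by blast
  obtain N where N: "\<forall>(X::'a set) (f::'a set \<Rightarrow> nat). finite X \<longrightarrow> N \<le> card X \<longrightarrow>
      f \<in> Pow X \<rightarrow> {1..t} \<longrightarrow> (\<exists>M\<in>nsets X p. \<forall>i<r. \<exists>k. \<forall>A\<in>nsets M i. f A = k)"
    using Suc.IH by blast
  show ?case
  proof (intro exI allI impI)
    fix X :: "'a set" and f :: "'a set \<Rightarrow> nat"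
    assume X: "finite X" "N \<le> card X" and f: "f \<in> Pow X \<rightarrow> {1..t}"
    obtain P where P: "P \<in> nsets X p" "\<forall>i<r. \<exists>k. \<forall>A\<in>nsets P i. f A = k"
      using N X f by blast
    have "f \<in> nsets P r \<rightarrow> {1..t}"
      using f P(1) by (auto simp: nsets_def Pi_iff)
    moreover have "finite P" "p \<le> card P"
      using P(1) by (auto simp: nsets_def)
    ultimately obtain M where M: "M \<in> nsets P m" "\<exists>k. \<forall>A\<in>nsets M r. f A = k"
      using p by blast
    have "nsets M i \<subseteq> nsets P i" for i
      using M(1) by (intro nsets_mono) (auto simp: nsets_def)
    then have "\<forall>i<Suc r. \<exists>k. \<forall>A\<in>nsets M i. f A = k"
      using P(2) M(2) by (metis less_Suc_eq subset_iff)
    moreover have "M \<in> nsets X m"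
      using M(1) P(1) by (auto simp: nsets_def)
    ultimately show "\<exists>M\<in>nsets X m. \<forall>i<Suc r. \<exists>k. \<forall>A\<in>nsets M i. f A = k"
      by blast
  qed
qed

text \<open>Images under an injective map commute with set difference and preserve cardinality, so a
  symmetric difference of size one keeps its size.\<close>

lemma cube_embedding_image:
  assumes inj: "inj_on h {1..m}" and sub: "h ` {1..m} \<subseteq> {1..n}"
  shows "cube_embedding m n (image h)"
proof -
  have "cube_adj (h ` A) (h ` B)" if "A \<subseteq> {1..m}" "B \<subseteq> {1..m}" "cube_adj A B" for A B
  proof -
    have "sym_diff (h ` A) (h ` B) = h ` sym_diff A B"
      using that inj_on_image_set_diff[OF inj, of A B] inj_on_image_set_diff[OF inj, of B A]
      by (simp add: image_Un Diff_subset[THEN subset_trans])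
    moreover have "card (h ` sym_diff A B) = card (sym_diff A B)"
      by (rule card_image, rule inj_on_subset[OF inj]) (use that in auto)
    ultimately show ?thesis
      using that(3) by (simp add: cube_adj_def)
  qed
  moreover have "image h \<in> Pow {1..m} \<rightarrow> Pow {1..n}"
    using sub by blast
  ultimately show ?thesis
    using inj_on_image_Pow[OF inj]
    by (simp add: cube_embedding_def hypercube_verts_def)
qed

lemma cube_embedding_comp:
  assumes "cube_embedding d m \<psi>" "cube_embedding m n \<phi>"
  shows "cube_embedding d n (\<phi> \<circ> \<psi>)"
proof -
  have \<psi>: "\<psi> \<in> hypercube_verts d \<rightarrow> hypercube_verts m"
    using assms(1) by (simp add: cube_embedding_def)
  have "inj_on (\<phi> \<circ> \<psi>) (hypercube_verts d)"
    using assms \<psi> by (intro comp_inj_on)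
      (auto simp: cube_embedding_def intro: inj_on_subset[of \<phi> "hypercube_verts m"])
  then show ?thesis
    using assms \<psi> by (simp add: cube_embedding_def Pi_iff)
qed

text \<open>Composing a copy of \<open>F\<close> in a class of \<open>c \<circ> \<phi>\<close> with
  \<open>\<phi>\<close> puts it in the class of \<open>c\<close> of the same color.\<close>

lemma has_mono_copy_pullback:
  assumes "has_mono_copy t d m (c \<circ> \<phi>) F" "cube_embedding m n \<phi>"
  shows "has_mono_copy t d n c F"
proof -
  obtain i \<psi> where i: "i \<in> {1..t}" and \<psi>: "cube_embedding d m \<psi>"
      and mono: "\<psi> ` F \<subseteq> color_class m (c \<circ> \<phi>) i"
    using assms(1) unfolding has_mono_copy_def contains_copy_def by blast
  have "(\<phi> \<circ> \<psi>) ` F \<subseteq> color_class n c i"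
    using mono assms(2) by (auto simp: color_class_def cube_embedding_def Pi_iff image_subset_iff)
  with i cube_embedding_comp[OF \<psi> assms(2)] show ?thesis
    unfolding has_mono_copy_def contains_copy_def by blast
qed

text \<open>A bijection \<open>h\<close> from \<open>{1..m}\<close> to the homogeneous set
  \<open>M\<close> induces \<open>\<phi> = image h\<close>, which sends layer \<open>i\<close> of
  the small cube to the \<open>i\<close>-subsets of \<open>M\<close>, where \<open>c\<close> is
  constant.\<close>

lemma layered_subcube:
  "\<exists>N. \<forall>n\<ge>N. \<forall>c. cube_coloring t n c \<longrightarrow>
     (\<exists>\<phi>. cube_embedding m n \<phi> \<and> cube_coloring t m (c \<circ> \<phi>) \<and> layered m (c \<circ> \<phi>))"
proof -
  \<comment> \<open>\<open>Suc m\<close> covers all sizes from 0 to \<open>m\<close>, including that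
    of the top vertex \<open>{1..m}\<close>.\<close>
  obtain N where N: "\<forall>(X::nat set) (f::nat set \<Rightarrow> nat). finite X \<longrightarrow> N \<le> card X \<longrightarrow>
      f \<in> Pow X \<rightarrow> {1..t} \<longrightarrow> (\<exists>M\<in>nsets X m. \<forall>i<Suc m. \<exists>k. \<forall>A\<in>nsets M i. f A = k)"
    using ramsey_layers by blast
  show ?thesis
  proof (intro exI[of _ N] allI impI)
    fix n c assume n: "N \<le> n" and c: "cube_coloring t n c"
    obtain M where M: "M \<in> nsets {1..n} m"
        and mono: "\<forall>i<Suc m. \<exists>k. \<forall>A\<in>nsets M i. c A = k"
      using N[rule_format, of "{1..n}" c] n c by (auto simp: cube_coloring_def hypercube_verts_def)
    obtain h where h: "bij_betw h {1..m} M"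
      using M finite_same_card_bij[of "{1..m}" M] by (auto simp: nsets_def)
    then have emb: "cube_embedding m n (image h)"
      using M by (intro cube_embedding_image) (auto simp: bij_betw_def nsets_def)
    have "(c \<circ> image h) A = (c \<circ> image h) B"
      if "A \<in> cube_layer m i" "B \<in> cube_layer m i" for A B i
    proof -
      \<comment> \<open>The bound on \<open>i\<close> comes from \<open>A\<close> itself: a layer
        with a vertex in it has index at most \<open>m\<close>.\<close>
      have *: "h ` A \<in> nsets M i \<and> i < Suc m" if "A \<in> cube_layer m i" for A
      proof -
        have A: "A \<subseteq> {1..m}" "card A = i"
          using that by (auto simp: cube_layer_def hypercube_verts_def)
        then have "card (h ` A) = i"
          using h by (metis card_image bij_betw_def inj_on_subset)
        moreover have "card A \<le> card {1..m}"
          using A by (intro card_mono) auto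
        moreover have "finite A"
          using A finite_subset by blast
        ultimately show ?thesis
          using A h by (auto simp: nsets_def bij_betw_def)
      qed
      show ?thesis
        using mono *[OF that(1)] *[OF that(2)] by (metis comp_apply)
    qed
    then have "layered m (c \<circ> image h)"
      unfolding layered_def by blast
    moreover have "cube_coloring t m (c \<circ> image h)"
      using c emb by (simp add: cube_coloring_def cube_embedding_def Pi_iff)
    ultimately show "\<exists>\<phi>. cube_embedding m n \<phi> \<and> cube_coloring t m (c \<circ> \<phi>) \<and> layered m (c \<circ> \<phi>)"
      using emb by blast
  qed
qed

theorem theorem2:
  fixes t d :: nat and S :: "nat set set"
  assumes "t \<ge> 2" and "d \<ge> 1" and "S \<subseteq> hypercube_verts d"
  shows "ramsey_set t d S \<longleftrightarrow> layer_ramsey_set t d S"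
proof
  show "ramsey_set t d S \<Longrightarrow> layer_ramsey_set t d S"
    unfolding ramsey_set_def layer_ramsey_set_def by blast
next
  assume "layer_ramsey_set t d S"
  then obtain m where "\<forall>c. cube_coloring t m c \<and> layered m c \<longrightarrow> has_mono_copy t d m c S"
    unfolding layer_ramsey_set_def by blast
  then show "ramsey_set t d S"
    \<comment> \<open>The threshold is the \<open>N\<close> that \<open>layered_subcube\<close>
      gives for the single dimension \<open>m\<close>.\<close>
    using layered_subcube[of t m] has_mono_copy_pullback unfolding ramsey_set_def by meson
qed

end
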